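(* Let $A$ be an admissible set of addition chains. Then: (1) For every integer $m\ge1$ there exists a finite $K\ge 0$ such that $2^K m$ is $A$-stable. (2) If $0\le\delta^A(m)<1$, then $m$ is $A$-stable.
   Context: An addition chain for a positive integer $n$ is a sequence $(a_0,\ldots,a_r)$ with $a_0=1$, $a_r=n$, and for every $1\le k\le r$ there exist $0\le i,j<k$ with $a_k=a_i+a_j$; $r$ is its length. For a set $A$ of addition chains, $\ell^A(n)$ is the least length of an addition chain for $n$ belonging to $A$. $\nu_2(n)$ is the number of $1$'s in the binary expansion of $n$. $A$ is admissible if (i) for every $n\ge1$, $\ell^A(n)$ is defined and $\ell^A(n)\le\lfloor\log_2 n\rfloor+\nu_2(n)-1$, and (ii) for every $n\ge1$, $\ell^A(2n)\le\ell^A(n)+1$. The $A$-defect is $\delta^A(n)=\ell^A(n)-\log_2 n$. A positive integer $m$ is $A$-stable if $\ell^A(2^k m)=\ell^A(m)+k$ for all $k\ge0$. *)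

theory Defs
  imports Complex_Main
begin

text \<open>A sequence \<open>(a\<^sub>0, \<dots>, a\<^sub>r)\<close> is a list of \<open>r + 1\<close> natural numbers. Its length as a chain
  is \<open>r\<close>, one less than its length as a list.\<close>

definition addition_chain_for :: "nat \<Rightarrow> nat list \<Rightarrow> bool" where
  "addition_chain_for n a \<longleftrightarrow>
     a \<noteq> [] \<and> a ! 0 = 1 \<and> last a = n \<and>
     (\<forall>k. 1 \<le> k \<and> k < length a \<longrightarrow> (\<exists>i<k. \<exists>j<k. a ! k = a ! i + a ! j))"

definition addition_chains :: "nat list set" where
  "addition_chains = {a. \<exists>n\<ge>1. addition_chain_for n a}"

definition chain_length :: "nat list \<Rightarrow> nat" where
  "chain_length a = length a - 1"

definition ell_defined :: "nat list set \<Rightarrow> nat \<Rightarrow> bool" where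
  "ell_defined A n \<longleftrightarrow> (\<exists>a\<in>A. addition_chain_for n a)"

text \<open>Only meaningful when \<^term>\<open>ell_defined A n\<close> holds.\<close>

definition ell :: "nat list set \<Rightarrow> nat \<Rightarrow> nat" where
  "ell A n = (LEAST r. \<exists>a\<in>A. addition_chain_for n a \<and> chain_length a = r)"

definition nu2 :: "nat \<Rightarrow> nat" where
  "nu2 n = card {k. bit n k}"

definition admissible :: "nat list set \<Rightarrow> bool" where
  "admissible A \<longleftrightarrow>
     A \<subseteq> addition_chains \<and>
     (\<forall>n\<ge>1. ell_defined A n \<and> int (ell A n) \<le> \<lfloor>log 2 (real n)\<rfloor> + int (nu2 n) - 1) \<and>
     (\<forall>n\<ge>1. ell A (2 * n) \<le> ell A n + 1)"

definition defect :: "nat list set \<Rightarrow> nat \<Rightarrow> real" where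
  "defect A n = real (ell A n) - log 2 (real n)"

definition A_stable :: "nat list set \<Rightarrow> nat \<Rightarrow> bool" where
  "A_stable A m \<longleftrightarrow> m \<ge> 1 \<and> (\<forall>k. ell A (2 ^ k * m) = ell A m + k)"

end

theory Submission
  imports Defs
begin

text \<open>Entries of a chain at most double at each step, so \<open>n \<le> 2 ^ ell A n\<close>
  (\<open>le_two_power_ell\<close>), while the doubling condition gives
  \<open>ell A (2 ^ k * m) \<le> ell A m + k\<close> (\<open>admissible_ell_power_le\<close>). Hence
  the integers \<open>ell A (2 ^ k * m) - k\<close> are nonincreasing in k and bounded below by log2
  m. Such a sequence attains a minimum and is constant from there on, which is stability of
  \<open>2 ^ K * m\<close>. If the defect of m is below 1, the first term exceeds log2 m by less
  than 1, so no smaller integer is available and the sequence is constant from k = 0.\<close>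

lemma addition_chain_nth_le:
  assumes "addition_chain_for n a" "k < length a"
  shows "a ! k \<le> 2 ^ k"
  using assms(2)
proof (induction k rule: less_induct)
  case (less k)
  show ?case
  proof (cases "k = 0")
    case True
    with assms(1) show ?thesis by (simp add: addition_chain_for_def)
  next
    case False
    with assms(1) less.prems obtain i j where ij: "i < k" "j < k" "a ! k = a ! i + a ! j"
      unfolding addition_chain_for_def by (metis One_nat_def Suc_leI not_gr_zero)
    \<comment> \<open>Both summands have index at most k - 1, so their sum is at most twice
      \<open>2 ^ (k - 1)\<close>.\<close>
    have "a ! i' \<le> 2 ^ (k - 1)" if "i' < k" for i'
    proof -
      have "a ! i' \<le> 2 ^ i'" using less that by simp
      also have "\<dots> \<le> 2 ^ (k - 1)" using that by (intro power_increasing) auto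
      finally show ?thesis .
    qed
    from this[OF ij(1)] this[OF ij(2)] ij(3) have "a ! k \<le> 2 * 2 ^ (k - 1)" by simp
    with False show ?thesis by (simp flip: power_Suc)
  qed
qed

lemma le_two_power_ell:
  assumes "ell_defined A n"
  shows "n \<le> 2 ^ ell A n"
proof -
  \<comment> \<open>Definedness ensures that the \<open>LEAST\<close> in \<open>ell\<close> is
    attained by an actual chain in A.\<close>
  have "\<exists>a\<in>A. addition_chain_for n a \<and> chain_length a = ell A n"
    using assms unfolding ell_def ell_defined_def by (rule_tac LeastI_ex) blast
  then obtain a where a: "addition_chain_for n a" "chain_length a = ell A n" by blast
  then have "a \<noteq> []" "last a = n" by (auto simp: addition_chain_for_def)
  with addition_chain_nth_le[OF a(1), of "length a - 1"] a(2) show ?thesis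
    by (simp add: chain_length_def last_conv_nth)
qed

lemma admissible_ell_power_le:
  assumes "admissible A" "m \<ge> 1"
  shows "ell A (2 ^ k * m) \<le> ell A m + k"
proof (induction k)
  case (Suc k)
  have "ell A (2 * (2 ^ k * m)) \<le> ell A (2 ^ k * m) + 1"
    using assms by (simp add: admissible_def)
  with Suc show ?case by (simp add: mult.assoc)
qed simp

lemma admissible_power_le:
  assumes "admissible A" "m \<ge> 1"
  shows "2 ^ k * m \<le> 2 ^ ell A (2 ^ k * m)"
  using assms by (intro le_two_power_ell) (simp add: admissible_def)

lemma admissible_exists_stable:
  assumes "admissible A" "m \<ge> 1"
  shows "\<exists>K. A_stable A (2 ^ K * m)"
proof -
  \<comment> \<open>This keeps the natural-number difference \<open>ell A (2 ^ k * m) - k\<close>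
    from being truncated at 0.\<close>
  have le: "k \<le> ell A (2 ^ k * m)" for k
  proof -
    have "2 ^ k \<le> 2 ^ k * m" using assms(2) by simp
    also have "\<dots> \<le> 2 ^ ell A (2 ^ k * m)" by (rule admissible_power_le[OF assms])
    finally show ?thesis by simp
  qed
  \<comment> \<open>K is an index where the difference is minimal. Minimality against the index k +
    K gives the lower bound for stability; repeated doubling gives the upper one.\<close>
  obtain K where K: "\<And>k. ell A (2 ^ K * m) - K \<le> ell A (2 ^ k * m) - k"
    using ex_has_least_nat[of "\<lambda>_. True" 0 "\<lambda>k. ell A (2 ^ k * m) - k"] by auto
  have "ell A (2 ^ k * (2 ^ K * m)) = ell A (2 ^ K * m) + k" for k
  proof (rule antisym)
    show "ell A (2 ^ k * (2 ^ K * m)) \<le> ell A (2 ^ K * m) + k"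
      using assms by (intro admissible_ell_power_le) auto
    have "2 ^ k * (2 ^ K * m) = 2 ^ (k + K) * m" by (simp add: power_add)
    then have "ell A (2 ^ k * (2 ^ K * m)) = ell A (2 ^ (k + K) * m)" by (rule arg_cong)
    then show "ell A (2 ^ K * m) + k \<le> ell A (2 ^ k * (2 ^ K * m))"
      using K[of "k + K"] le[of K] le[of "k + K"] by linarith
  qed
  with assms(2) show ?thesis unfolding A_stable_def by (intro exI[of _ K]) auto
qed

lemma admissible_stable_if_defect_less_1:
  assumes "admissible A" "m \<ge> 1" "defect A m < 1"
  shows "A_stable A m"
proof -
  have "ell A m + k \<le> ell A (2 ^ k * m)" for k
  proof -
    have "real (2 ^ k * m) \<le> 2 ^ ell A (2 ^ k * m)"
      using admissible_power_le[OF assms(1,2), of k] by (metis of_nat_le_iff of_nat_numeral of_nat_power)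
    then have "log 2 (real (2 ^ k * m)) \<le> real (ell A (2 ^ k * m))"
      using assms(2) by (simp add: log_le_iff powr_realpow del: of_nat_mult of_nat_power)
    moreover have "log 2 (real (2 ^ k * m)) = real k + log 2 (real m)"
      using assms(2) by (simp add: log_mult log_nat_power)
    \<comment> \<open>Here \<open>ell A (2 ^ k * m) \<ge> k + log 2 m > k + ell A m - 1\<close>, and
      integrality closes the gap of 1.\<close>
    ultimately show ?thesis using assms(3) unfolding defect_def by linarith
  qed
  with admissible_ell_power_le[OF assms(1,2)] assms(2) show ?thesis
    unfolding A_stable_def by (auto intro: antisym)
qed

theorem theorem3p3:
  fixes A :: "nat list set"
  assumes "admissible A"
  shows "(\<forall>m\<ge>1. \<exists>K. A_stable A (2 ^ K * m)) \<and>
         (\<forall>m\<ge>1. 0 \<le> defect A m \<and> defect A m < 1 \<longrightarrow> A_stable A m)"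
  using assms admissible_exists_stable admissible_stable_if_defect_less_1 by blast

end
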